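(* Let $G$ be a circle graph with clique number $\omega$. Then the vertex set of $G$ can be partitioned into $7\omega$ (possibly empty) sets, each of which induces a permutation graph in $G$.
   Context: An interval system is a finite set $\mathcal{I}$ of open intervals $(a,b)$, $a<b$, contained in $(0,1)$, such that no two distinct intervals share an end and no interval has $0$ or $1$ as an end. Two intervals overlap if they intersect and neither is contained in the other. The overlap graph $G(\mathcal{I})$ is the graph with vertex set $\mathcal{I}$ in which two vertices are adjacent if and only if they overlap as intervals. A graph is a circle graph if it is isomorphic to the overlap graph of an interval system. A pillar of an interval system $\mathcal{I}$ is a point of $(0,1)$ that is not an end of any interval in $\mathcal{I}$. A graph is a permutation graph if it is isomorphic to the overlap graph of an interval system for which there exists a pillar contained in every interval of the system. *)

theory Defs
  imports Complex_Main "HOL-Library.Ramsey" "HOL-Library.Disjoint_Sets"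
begin

text \<open>
  Graphs are finite, simple and undirected. They are given by a vertex set and a set of
  two-element edges, the format used by \<^const>\<open>clique\<close> from \<^theory>\<open>HOL-Library.Ramsey\<close>.
\<close>

definition simple_graph :: "'a set \<Rightarrow> 'a set set \<Rightarrow> bool" where
  "simple_graph V E \<longleftrightarrow> finite V \<and> E \<subseteq> [V]\<^bsup>2\<^esup>"

definition graph_isomorphic :: "'a set \<Rightarrow> 'a set set \<Rightarrow> 'b set \<Rightarrow> 'b set set \<Rightarrow> bool" where
  "graph_isomorphic V E W F \<longleftrightarrow>
     (\<exists>f. bij_betw f V W \<and> (\<forall>u\<in>V. \<forall>v\<in>V. {u, v} \<in> E \<longleftrightarrow> {f u, f v} \<in> F))"

definition induced_edges :: "'a set set \<Rightarrow> 'a set \<Rightarrow> 'a set set" where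
  "induced_edges E X = {e \<in> E. e \<subseteq> X}"

definition clique_number :: "'a set \<Rightarrow> 'a set set \<Rightarrow> nat" where
  "clique_number V E = Max {card K | K. K \<subseteq> V \<and> clique K E}"

text \<open>
  A pair \<open>(a, b)\<close> with \<open>a < b\<close> represents the open interval \<open>{a<..<b}\<close>; distinct such pairs
  represent distinct intervals.
\<close>

type_synonym interval = "real \<times> real"

definition points :: "interval \<Rightarrow> real set" where
  "points I = {fst I<..<snd I}"

definition ends :: "interval \<Rightarrow> real set" where
  "ends I = {fst I, snd I}"

definition interval_system :: "interval set \<Rightarrow> bool" where
  "interval_system S \<longleftrightarrow>
     finite S \<and>
     (\<forall>I\<in>S. fst I < snd I \<and> points I \<subseteq> {0<..<1} \<and> 0 \<notin> ends I \<and> 1 \<notin> ends I) \<and>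
     (\<forall>I\<in>S. \<forall>J\<in>S. I \<noteq> J \<longrightarrow> ends I \<inter> ends J = {})"

definition overlap :: "interval \<Rightarrow> interval \<Rightarrow> bool" where
  "overlap I J \<longleftrightarrow>
     points I \<inter> points J \<noteq> {} \<and> \<not> points I \<subseteq> points J \<and> \<not> points J \<subseteq> points I"

text \<open>The overlap graph of \<open>S\<close> has vertex set \<open>S\<close> and the following edges.\<close>

definition overlap_edges :: "interval set \<Rightarrow> interval set set" where
  "overlap_edges S = {{I, J} | I J. I \<in> S \<and> J \<in> S \<and> overlap I J}"

definition pillar :: "interval set \<Rightarrow> real \<Rightarrow> bool" where
  "pillar S p \<longleftrightarrow> p \<in> {0<..<1} \<and> (\<forall>I\<in>S. p \<notin> ends I)"

definition circle_graph :: "'a set \<Rightarrow> 'a set set \<Rightarrow> bool" where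
  "circle_graph V E \<longleftrightarrow>
     simple_graph V E \<and>
     (\<exists>S. interval_system S \<and> graph_isomorphic V E S (overlap_edges S))"

definition permutation_graph :: "'a set \<Rightarrow> 'a set set \<Rightarrow> bool" where
  "permutation_graph V E \<longleftrightarrow>
     simple_graph V E \<and>
     (\<exists>S. interval_system S \<and> (\<exists>p. pillar S p \<and> (\<forall>I\<in>S. p \<in> points I)) \<and>
       graph_isomorphic V E S (overlap_edges S))"

lemma simple_graph_overlap:
  assumes "interval_system S"
  shows "simple_graph S (overlap_edges S)"
  using assms by (auto simp: simple_graph_def interval_system_def overlap_edges_def overlap_def)

end

theory Submission
  imports Defs
begin

text \<open>
  Create pillars one after another, assign each interval to its first pillar, and colour the
  pillars so that overlapping intervals with different pillars get different colours; a colour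
  class is then a disjoint union of permutation graphs, hence a permutation graph. Say that a
  segment between neighbouring pillars sees the pillars of those assigned intervals that have an
  end in it. A new pillar in a segment only has to avoid the colours seen by the segment, and we
  maintain that each segment that still has to be treated sees at most \<open>5\<omega>\<close> pillars.
  To cut a segment, add a pillar in an interval inside it, and cut both sides further into pieces
  that see at most \<open>3\<omega>\<close> of the old pillars. For a greedy choice of \<open>k\<close> cuts there are more than
  \<open>3\<omega>k\<close> pairs of an old pillar and a piece seeing it. Around the circle these pairs
  are bipartite chords without \<open>\<omega> + 1\<close> pairwise crossing ones, so there are at most \<open>\<omega>(5\<omega> + k)\<close> of
  them and \<open>k < 2\<^sup>2\<^sup>\<omega>\<^sup>-\<^sup>1\<close>. Creating the cuts in the order of a balanced binary tree, every
  piece sees at most \<open>2\<omega>\<close> new pillars, and never more than \<open>7\<omega>\<close> colours are needed.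
\<close>

section \<open>Overlap of intervals and nesting of permutation graphs\<close>

lemma overlap_iff:
  assumes "fst I < snd I" "fst J < snd J"
  shows "overlap I J \<longleftrightarrow>
    (fst I < fst J \<and> fst J < snd I \<and> snd I < snd J) \<or>
    (fst J < fst I \<and> fst I < snd J \<and> snd J < snd I)"
proof -
  have "points I \<inter> points J \<noteq> {} \<longleftrightarrow> fst J < snd I \<and> fst I < snd J"
    using assms by (auto simp: points_def Int_greaterThanLessThan)
  then show ?thesis
    using assms
    by (auto simp: overlap_def points_def greaterThanLessThan_subseteq_greaterThanLessThan not_le)
qed

lemma overlap_sym: "overlap I J \<longleftrightarrow> overlap J I"
  by (auto simp: overlap_def)

lemma interval_systemD:
  assumes "interval_system S" "I \<in> S"
  shows "fst I < snd I" "0 < fst I" "snd I < 1"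
proof -
  have *: "fst I < snd I" "points I \<subseteq> {0<..<1}" "0 \<noteq> fst I" "1 \<noteq> snd I"
    using assms by (auto simp: interval_system_def ends_def)
  then have "0 \<le> fst I" "snd I \<le> 1"
    by (auto simp: points_def greaterThanLessThan_subseteq_greaterThanLessThan)
  then show "fst I < snd I" "0 < fst I" "snd I < 1"
    using * by auto
qed

lemma interval_system_subset:
  assumes "interval_system S" "T \<subseteq> S"
  shows "interval_system T"
  using assms unfolding interval_system_def by (meson finite_subset subsetD)

lemma overlap_edges_iff:
  assumes "I \<in> S" "J \<in> S"
  shows "{I, J} \<in> overlap_edges S \<longleftrightarrow> overlap I J"
proof
  assume "{I, J} \<in> overlap_edges S"
  then obtain I' J' where "{I, J} = {I', J'}" "overlap I' J'"
    by (auto simp: overlap_edges_def)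
  then show "overlap I J" by (auto simp: doubleton_eq_iff overlap_sym)
qed (use assms in \<open>unfold overlap_edges_def, blast\<close>)

text \<open>Groups of intervals without overlaps between different groups are nested around \<open>1/2\<close>,
  the intervals of one group all containing those of the previous ones.\<close>

lemma permutation_graph_of_pillars:
  fixes \<pi> :: "interval \<Rightarrow> real"
  assumes S: "interval_system S"
    and in_points: "\<And>I. I \<in> S \<Longrightarrow> \<pi> I \<in> points I"
    and same: "\<And>I J. I \<in> S \<Longrightarrow> J \<in> S \<Longrightarrow> overlap I J \<Longrightarrow> \<pi> I = \<pi> J"
  shows "permutation_graph S (overlap_edges S)"
proof -
  have fin: "finite S"
    using S by (simp add: interval_system_def)
  define n where "n = card (\<pi> ` S)"
  obtain r0 where r0: "bij_betw r0 (\<pi> ` S) {..<n}"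
    using ex_bij_betw_finite_nat[of "\<pi> ` S"] fin by (auto simp: n_def atLeast0LessThan)
  define r where "r I = r0 (\<pi> I)" for I
  have r_less: "r I < n" if "I \<in> S" for I
    using r0 that by (auto simp: r_def bij_betw_def)
  have r_eq: "r I = r J \<longleftrightarrow> \<pi> I = \<pi> J" if "I \<in> S" "J \<in> S" for I J
    using r0 that by (auto simp: r_def bij_betw_def inj_on_def)
  \<comment> \<open>Distances of the new ends from \<open>1/2\<close>, before scaling. For
    \<open>I\<close> in \<open>S\<close> both lie strictly between \<open>r I\<close> and
    \<open>r I + 1\<close>, so groups of different rank are nested; within a group, left ends and
    right ends are each only translated and keep their order.\<close>
  define \<alpha> \<beta> where "\<alpha> I = real (r I) + 1 - fst I" and "\<beta> I = real (r I) + snd I"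
    for I :: interval
  \<comment> \<open>All distances are below \<open>n\<close>, hence below \<open>M / 2\<close>,
    which keeps the new intervals inside the unit interval.\<close>
  define M where "M = 2 * (real n + 1)"
  have M: "M > 0" by (simp add: M_def)
  define h where "h I = (1/2 - \<alpha> I / M, 1/2 + \<beta> I / M)" for I
  note D = interval_systemD[OF S]
  have ends: "fst I \<noteq> fst J" "snd I \<noteq> snd J" if "I \<in> S" "J \<in> S" "I \<noteq> J" for I J
    using S that by (auto simp: interval_system_def ends_def)
  have \<alpha>: "0 < \<alpha> I" "\<alpha> I < M / 2" and \<beta>: "0 < \<beta> I" "\<beta> I < M / 2" if "I \<in> S" for I
    using D[OF that] r_less[OF that] by (auto simp: \<alpha>_def \<beta>_def M_def)
  have h: "0 < fst (h I)" "fst (h I) < 1/2" "1/2 < snd (h I)" "snd (h I) < 1" if "I \<in> S" for I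
    using \<alpha>[OF that] \<beta>[OF that] M by (auto simp: h_def field_simps)
  have lt: "fst (h I) < fst (h J) \<longleftrightarrow> \<alpha> J < \<alpha> I" "snd (h I) < snd (h J) \<longleftrightarrow> \<beta> I < \<beta> J" for I J
    using M by (auto simp: h_def divide_strict_right_mono divide_less_cancel)
  have less: "\<alpha> I < \<alpha> J \<and> \<beta> I < \<beta> J" if "I \<in> S" "J \<in> S" "r I < r J" for I J
  proof -
    have "real (r I) + 1 \<le> real (r J)" using that(3) by simp
    then show ?thesis
      using D[OF that(1)] D[OF that(2)] by (auto simp: \<alpha>_def \<beta>_def)
  qed
  have neq: "\<alpha> I \<noteq> \<alpha> J \<and> \<beta> I \<noteq> \<beta> J" if "I \<in> S" "J \<in> S" "I \<noteq> J" for I J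
  proof (cases "r I = r J")
    case True
    then show ?thesis using ends[OF that] by (auto simp: \<alpha>_def \<beta>_def)
  next
    case False
    then show ?thesis using less[of I J] less[of J I] that by (cases "r I < r J") auto
  qed
  have h_neq: "fst (h I) \<noteq> fst (h J) \<and> snd (h I) \<noteq> snd (h J)" if "I \<in> S" "J \<in> S" "I \<noteq> J" for I J
    using neq[OF that] M by (auto simp: h_def)
  have ov: "overlap (h I) (h J) \<longleftrightarrow> overlap I J" if I: "I \<in> S" and J: "J \<in> S" for I J
  proof -
    have 1: "overlap (h I) (h J) \<longleftrightarrow> \<alpha> J < \<alpha> I \<and> \<beta> I < \<beta> J \<or> \<alpha> I < \<alpha> J \<and> \<beta> J < \<beta> I"
      using h[OF I] h[OF J] by (subst overlap_iff) (auto simp: lt)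
    show ?thesis
    proof (cases "r I = r J")
      case True
      then have "\<pi> I = \<pi> J" using r_eq I J by simp
      \<comment> \<open>The common pillar puts both left ends before both right ends, so overlap
        depends only on the order of the left ends and that of the right ends.\<close>
      then have "fst I < snd J" "fst J < snd I"
        using in_points[OF I] in_points[OF J] by (auto simp: points_def)
      then show ?thesis
        unfolding 1 using D[OF I] D[OF J] True
        by (subst overlap_iff) (auto simp: \<alpha>_def \<beta>_def)
    next
      case False
      then have "\<not> overlap I J" using same r_eq I J by blast
      moreover have "r I < r J \<or> r J < r I" using False by auto
      ultimately show ?thesis
        unfolding 1 using less[OF I J] less[OF J I] by auto
    qed
  qed
  have inj: "inj_on h S"
    using h_neq by (metis inj_onI)
  have "interval_system (h ` S)"
    unfolding interval_system_def
  proof (intro conjI ballI impI)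
    show "finite (h ` S)" using fin by simp
  next
    fix K assume "K \<in> h ` S"
    then obtain I where I: "I \<in> S" "K = h I" by auto
    then show "fst K < snd K" "points K \<subseteq> {0<..<1}" "0 \<notin> ends K" "1 \<notin> ends K"
      using h[OF I(1)] by (auto simp: points_def ends_def)
  next
    fix K L assume "K \<in> h ` S" "L \<in> h ` S" "K \<noteq> L"
    then obtain I J where IJ: "I \<in> S" "J \<in> S" "I \<noteq> J" "K = h I" "L = h J" by auto
    then show "ends K \<inter> ends L = {}"
      using h[OF IJ(1)] h[OF IJ(2)] h_neq[OF IJ(1,2,3)] by (auto simp: ends_def)
  qed
  moreover have "pillar (h ` S) (1/2)"
    using h by (auto simp: pillar_def ends_def less_le)
  moreover have "\<forall>K\<in>h ` S. 1/2 \<in> points K"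
    using h by (auto simp: points_def)
  moreover have "graph_isomorphic S (overlap_edges S) (h ` S) (overlap_edges (h ` S))"
    unfolding graph_isomorphic_def
    using inj ov by (intro exI[of _ h]) (auto simp: bij_betw_def overlap_edges_iff)
  ultimately show ?thesis
    unfolding permutation_graph_def using simple_graph_overlap[OF S] by blast
qed

section \<open>Pillars seen and greedy cuts\<close>

definition pillars_seen :: "(interval \<Rightarrow> real) \<Rightarrow> interval set \<Rightarrow> real set \<Rightarrow> real set" where
  "pillars_seen \<pi> F B = \<pi> ` {I \<in> F. ends I \<inter> B \<noteq> {}}"

lemma finite_pillars_seen [simp]: "finite F \<Longrightarrow> finite (pillars_seen \<pi> F B)"
  by (simp add: pillars_seen_def)

lemma card_pillars_seen_mono:
  assumes "finite F" "B \<subseteq> B'"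
  shows "card (pillars_seen \<pi> F B) \<le> card (pillars_seen \<pi> F B')"
  using assms by (intro card_mono) (auto simp: pillars_seen_def)

primrec cuttable :: "(real \<Rightarrow> real \<Rightarrow> bool) \<Rightarrow> nat \<Rightarrow> real \<Rightarrow> real \<Rightarrow> bool" where
  "cuttable Q 0 s t \<longleftrightarrow> Q s t"
| "cuttable Q (Suc n) s t \<longleftrightarrow> (\<exists>p. s < p \<and> p < t \<and> Q s p \<and> cuttable Q n p t)"

lemma cuttable_mono:
  assumes "cuttable Q n s t" "\<And>u v. s \<le> u \<Longrightarrow> v \<le> t \<Longrightarrow> Q u v \<Longrightarrow> R u v"
  shows "cuttable R n s t"
  using assms
proof (induction n arbitrary: s)
  case (Suc n)
  then obtain p where "s < p" "p < t" "Q s p" "cuttable Q n p t" by auto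
  with Suc.IH[of p] Suc.prems(2) show ?case by force
qed auto

text \<open>Singles out any chosen one of the cut points, so that cuts listed from left to right can
  be made in the order of a binary tree.\<close>

lemma cuttable_split:
  assumes "cuttable Q (Suc (m + n)) s t"
  shows "\<exists>p. s < p \<and> p < t \<and> cuttable Q m s p \<and> cuttable Q n p t"
  using assms
proof (induction m arbitrary: s)
  case (Suc m)
  then obtain q where q: "s < q" "Q s q" "cuttable Q (Suc (m + n)) q t" by auto
  from Suc.IH[OF q(3)] obtain p where "q < p" "p < t" "cuttable Q m q p" "cuttable Q n p t"
    by auto
  with q show ?case by (intro exI[of _ p]) auto
qed auto

text \<open>Only finitely many ends lie in the segment; nothing is seen beyond the last of them,
  which serves as \<open>q\<close>.\<close>

lemma pillars_seen_half_open:
  assumes "finite F" "pillars_seen \<pi> F {s<..<t} \<noteq> {}"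
  obtains q where "q \<in> (\<Union>I\<in>F. ends I) \<inter> {s<..<t}"
    "pillars_seen \<pi> F {s<..<t} = pillars_seen \<pi> F {s<..q}"
proof -
  let ?U = "(\<Union>I\<in>F. ends I) \<inter> {s<..<t}"
  have fin: "finite ?U" using assms(1) by (auto simp: ends_def)
  have "?U \<noteq> {}" using assms(2) by (auto simp: pillars_seen_def)
  then have m: "Max ?U \<in> ?U" using fin by (rule Max_in[rotated])
  have "ends I \<inter> {s<..<t} = ends I \<inter> {s<..Max ?U}" if "I \<in> F" for I
    using that m Max_ge[OF fin] by fastforce
  then have "{I \<in> F. ends I \<inter> {s<..<t} \<noteq> {}} = {I \<in> F. ends I \<inter> {s<..Max ?U} \<noteq> {}}"
    by blast
  with m show ?thesis by (intro that[of "Max ?U"]) (simp_all add: pillars_seen_def)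
qed

text \<open>Greedy choice: cut at the first end \<open>q\<close> for which \<open>{s<..q}\<close>
  sees more than \<open>e\<close> pillars. The open piece before \<open>q\<close> still sees at most
  \<open>e\<close>, while the half-open pieces are disjoint and each sees more than
  \<open>e\<close>. Either fewer than \<open>k\<close> cuts reach \<open>t\<close>, or the first
  \<open>k\<close> cuts form the chain.\<close>

lemma cuttable_or_chain:
  assumes "finite F" "s < t"
  shows "(\<exists>n<k. cuttable (\<lambda>u v. card (pillars_seen \<pi> F {u<..<v}) \<le> e) n s t) \<or>
    (\<exists>p. p 0 = s \<and> p k < t \<and>
      (\<forall>j<k. p j < p (Suc j) \<and> e < card (pillars_seen \<pi> F {p j<..p (Suc j)})))"
  using assms(2)
proof (induction k arbitrary: s)
  case 0
  then show ?case by auto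
next
  case (Suc k)
  show ?case
  proof (cases "card (pillars_seen \<pi> F {s<..<t}) \<le> e")
    case True
    then show ?thesis by (intro disjI1 exI[of _ 0]) auto
  next
    case False
    define A where "A = {q \<in> (\<Union>I\<in>F. ends I) \<inter> {s<..<t}. e < card (pillars_seen \<pi> F {s<..q})}"
    define q where "q = Min A"
    have A: "finite A" using assms(1) by (auto simp: A_def ends_def)
    \<comment> \<open>Used twice: \<open>v = t\<close> makes \<open>A\<close> nonempty, and
      \<open>v = q\<close> shows by minimality that the open piece before \<open>q\<close> stays
      within the bound.\<close>
    have in_A: "\<exists>r\<in>A. r < v" if *: "e < card (pillars_seen \<pi> F {s<..<v})" and "v \<le> t" for v
    proof -
      have "pillars_seen \<pi> F {s<..<v} \<noteq> {}" using * by auto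
      then obtain r where "r \<in> (\<Union>I\<in>F. ends I) \<inter> {s<..<v}"
        "pillars_seen \<pi> F {s<..<v} = pillars_seen \<pi> F {s<..r}"
        using pillars_seen_half_open[OF assms(1)] by metis
      then show ?thesis using * \<open>v \<le> t\<close> by (intro bexI[of _ r]) (auto simp: A_def)
    qed
    have "q \<in> A" using in_A[of t] False A unfolding q_def by (intro Min_in) auto
    then have q1: "s < q" "q < t" "e < card (pillars_seen \<pi> F {s<..q})"
      by (auto simp: A_def)
    have q2: "card (pillars_seen \<pi> F {s<..<q}) \<le> e"
    proof (rule ccontr)
      assume "\<not> ?thesis"
      then obtain r where "r \<in> A" "r < q" using in_A[of q] q1 by auto
      then show False using Min_le[OF A, of r] by (simp add: q_def)
    qed
      from Suc.IH[OF q1(2)] show ?thesis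
    proof (elim disjE exE conjE)
      fix n assume "n < k" "cuttable (\<lambda>u v. card (pillars_seen \<pi> F {u<..<v}) \<le> e) n q t"
      then show ?thesis using q1 q2 by (intro disjI1 exI[of _ "Suc n"]) auto
    next
      fix p :: "nat \<Rightarrow> real" assume "p 0 = q" "p k < t"
        "\<forall>j<k. p j < p (Suc j) \<and> e < card (pillars_seen \<pi> F {p j<..p (Suc j)})"
      then show ?thesis using q1
        by (intro disjI2 exI[of _ "case_nat s p"]) (auto simp: less_Suc_eq_0_disj)
    qed
  qed
qed

section \<open>Valid assignments and the chain count around the circle\<close>

locale bounded_interval_system =
  fixes S :: "interval set" and w :: nat
  assumes system: "interval_system S"
    and clique_le: "\<And>K. K \<subseteq> S \<Longrightarrow> (\<And>I J. I \<in> K \<Longrightarrow> J \<in> K \<Longrightarrow> I \<noteq> J \<Longrightarrow> overlap I J) \<Longrightarrow> card K \<le> w"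
begin

lemmas interval = interval_systemD[OF system]

lemma finite_subset_system: "F \<subseteq> S \<Longrightarrow> finite F"
  using system by (auto simp: interval_system_def intro: finite_subset)

text \<open>The order in which pillars are created is not recorded. What remains of assigning each
  interval to its first pillar is the disjunction: the older of two pillars lies outside every
  interval assigned to the newer one.\<close>

definition valid :: "interval set \<Rightarrow> (interval \<Rightarrow> real) \<Rightarrow> (real \<Rightarrow> nat) \<Rightarrow> bool" where
  "valid F \<pi> c \<longleftrightarrow> F \<subseteq> S \<and> (\<forall>I\<in>F. \<pi> I \<in> points I \<and> c (\<pi> I) < 7 * w) \<and>
    (\<forall>I\<in>F. \<forall>J\<in>F. \<pi> I \<noteq> \<pi> J \<longrightarrow>
      (\<pi> I \<notin> points J \<or> \<pi> J \<notin> points I) \<and> (overlap I J \<longrightarrow> c (\<pi> I) \<noteq> c (\<pi> J)))"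

text \<open>Seen from a segment, the pillars on a circle through \<open>0 = 1\<close> are met in the order of this
  key; pillars lie in \<open>(0,1)\<close>, so those to the right of the segment come first.\<close>

definition circular_key :: "real \<Rightarrow> real \<Rightarrow> real" where
  "circular_key s x = (if x \<le> s then x + 1 else x)"

lemma circular_key_inj:
  assumes "x \<in> {0<..<1}" "y \<in> {0<..<1}" "circular_key s x = circular_key s y"
  shows "x = y"
  using assms by (auto simp: circular_key_def split: if_splits)

text \<open>A pillar left of the segment forces the end inside to be the right end, a pillar to the
  right forces the left end. If the pillars lie on the same side, one interval contains both of
  them, so the other pillar is missed by the other interval, which fixes the order of the far ends.
  If they lie on opposite sides, the keys put \<open>\<pi> I\<close> on the right and
  \<open>\<pi> J\<close> on the left, and \<open>u < v\<close> gives the overlap directly.\<close>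

lemma overlap_if_circular_key_less:
  assumes V: "valid F \<pi> c" and I: "I \<in> F" "\<pi> I \<notin> {s<..<t}" "u \<in> ends I" "u \<in> {s<..<t}"
    and J: "J \<in> F" "\<pi> J \<notin> {s<..<t}" "v \<in> ends J" "v \<in> {s<..<t}"
    and "u < v" and key: "circular_key s (\<pi> I) < circular_key s (\<pi> J)"
  shows "overlap I J"
proof -
  have "I \<in> S" "J \<in> S" using V I J by (auto simp: valid_def)
  note ends = interval[OF this(1)] interval[OF this(2)]
  have p: "fst I < \<pi> I" "\<pi> I < snd I" "fst J < \<pi> J" "\<pi> J < snd J"
    using V I J by (auto simp: valid_def points_def)
  have "\<pi> I \<noteq> \<pi> J" using key by auto
  then have age: "\<pi> I \<notin> points J \<or> \<pi> J \<notin> points I" using V I J by (auto simp: valid_def)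
  have Iu: "if \<pi> I \<le> s then u = snd I else t \<le> \<pi> I \<and> u = fst I"
    using I p by (auto simp: ends_def)
  have Jv: "if \<pi> J \<le> s then v = snd J else t \<le> \<pi> J \<and> v = fst J"
    using J p by (auto simp: ends_def)
  show ?thesis
    using Iu Jv p age key ends I J \<open>u < v\<close>
    by (subst overlap_iff) (auto simp: circular_key_def points_def split: if_splits)
qed

text \<open>Count the pairs of a pillar and a piece seeing it: on a diagonal, where the rank of the
  pillar and the index of the piece increase together, the corresponding intervals overlap
  pairwise, so each diagonal contributes at most \<open>w\<close> pairs.\<close>

lemma chain_length:
  assumes V: "valid F \<pi> c" and out: "\<And>I. I \<in> F \<Longrightarrow> \<pi> I \<notin> {s<..<t}"
    and d: "card (pillars_seen \<pi> F {s<..<t}) \<le> d"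
    and p0: "p 0 = s" and pk: "p k < t"
    and chain: "\<forall>j<k. p j < p (Suc j) \<and> e < card (pillars_seen \<pi> F {p j<..p (Suc j)})"
  shows "k * Suc e \<le> w * (d + k)"
proof -
  have FS: "F \<subseteq> S" using V by (simp add: valid_def)
  have finF: "finite F" using FS by (rule finite_subset_system)
  define L where "L = pillars_seen \<pi> F {s<..<t}"
  have finL: "finite L" using finF by (simp add: L_def)
  define piece where "piece j = {p j<..p (Suc j)}" for j
  have mono: "p i \<le> p j" if "i \<le> j" "j \<le> k" for i j
    using that
  proof (induction rule: dec_induct)
    case (step n)
    then show ?case using chain[rule_format, of n] by simp
  qed simp
  have piece: "piece j \<subseteq> {s<..<t}" if "j < k" for j
    using mono[of 0 j] mono[of "Suc j" k] that p0 pk by (auto simp: piece_def)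
  have piece_less: "u < v" if "u \<in> piece i" "v \<in> piece j" "i < j" "j < k" for u v i j
    using mono[of "Suc i" j] that by (auto simp: piece_def)
  define Z where "Z = (SIGMA j:{..<k}. pillars_seen \<pi> F (piece j))"
  define I where "I z = (SOME I. I \<in> F \<and> \<pi> I = snd z \<and> ends I \<inter> piece (fst z) \<noteq> {})" for z
  have I: "I z \<in> F \<and> \<pi> (I z) = snd z \<and> ends (I z) \<inter> piece (fst z) \<noteq> {}" if "z \<in> Z" for z
  proof -
    have "\<exists>I. I \<in> F \<and> \<pi> I = snd z \<and> ends I \<inter> piece (fst z) \<noteq> {}"
      using that by (cases z) (auto simp only: Z_def pillars_seen_def mem_Sigma_iff fst_conv snd_conv)
    then show ?thesis unfolding I_def by (rule someI_ex)
  qed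
  have ZL: "snd z \<in> L" "fst z < k" if "z \<in> Z" for z
    using that piece by (fastforce simp: Z_def L_def pillars_seen_def)+
  have L01: "L \<subseteq> {0<..<1}"
    using V FS interval by (fastforce simp: L_def pillars_seen_def valid_def points_def)
  define rk where "rk x = card {y \<in> L. circular_key s y < circular_key s x}" for x
  have rk_less: "rk x < card L" if "x \<in> L" for x
    unfolding rk_def using finL that by (intro psubset_card_mono) auto
  have key_less: "circular_key s x < circular_key s y" if "rk x < rk y" for x y
  proof (rule ccontr)
    assume "\<not> ?thesis"
    then have "rk y \<le> rk x" unfolding rk_def using finL by (intro card_mono) auto
    then show False using that by simp
  qed
  have rk_inj: "x = y" if "x \<in> L" "y \<in> L" "rk x = rk y" for x y
  proof (rule ccontr)
    assume "x \<noteq> y"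
    have *: "rk a < rk b" if "a \<in> L" "circular_key s a < circular_key s b" for a b
      unfolding rk_def using finL that by (intro psubset_card_mono) auto
    have "circular_key s x \<noteq> circular_key s y"
      using circular_key_inj L01 that \<open>x \<noteq> y\<close> by blast
    then show False using *[of x y] *[of y x] that by (cases rule: linorder_cases) auto
  qed
  \<comment> \<open>The number of the diagonal. Adding \<open>k\<close>, which exceeds
    \<open>fst z\<close>, keeps the subtraction from truncating; ranks below \<open>d\<close> leave
    \<open>d + k\<close> possible values.\<close>
  define \<delta> where "\<delta> z = rk (snd z) + k - fst z" for z
  have \<delta>: "\<delta> z < d + k" if "z \<in> Z" for z
    using rk_less[OF ZL(1)[OF that]] ZL(2)[OF that] d by (auto simp: \<delta>_def L_def)
  have ov: "overlap (I y) (I z)" if yz: "y \<in> Z" "z \<in> Z" "\<delta> y = \<delta> z" "fst y < fst z" for y z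
  proof -
    have "rk (snd y) < rk (snd z)" using yz ZL(2)[of y] ZL(2)[of z] by (auto simp: \<delta>_def)
    then have key: "circular_key s (\<pi> (I y)) < circular_key s (\<pi> (I z))"
      using key_less I yz by simp
    obtain u where u: "u \<in> ends (I y)" "u \<in> piece (fst y)" using I[OF yz(1)] by blast
    obtain v where v: "v \<in> ends (I z)" "v \<in> piece (fst z)" using I[OF yz(2)] by blast
    have "u < v" using piece_less[OF u(2) v(2) yz(4)] ZL(2)[OF yz(2)] .
    moreover have "u \<in> {s<..<t}" "v \<in> {s<..<t}"
      using u(2) v(2) piece[OF ZL(2)[OF yz(1)]] piece[OF ZL(2)[OF yz(2)]] by blast+
    moreover have "I y \<in> F" "I z \<in> F" using I yz by auto
    ultimately show ?thesis
      using overlap_if_circular_key_less[OF V _ _ u(1) _ _ _ v(1) _ _ key] out by blast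
  qed
  have fiber: "card {z \<in> Z. \<delta> z = m} \<le> w" for m
  proof -
    have eq: "y = z" if "y \<in> Z" "z \<in> Z" "\<delta> y = \<delta> z" "fst y = fst z" for y z
    proof -
      have "rk (snd y) = rk (snd z)" using that ZL(2)[of y] ZL(2)[of z] by (auto simp: \<delta>_def)
      then show ?thesis using rk_inj ZL(1) that by (metis prod_eqI)
    qed
    have cross: "overlap (I y) (I z)" if "y \<in> Z" "z \<in> Z" "\<delta> y = m" "\<delta> z = m" "y \<noteq> z" for y z
      using ov[of y z] ov[of z y] eq[of y z] that overlap_sym by (cases "fst y" "fst z" rule: linorder_cases) auto
    \<comment> \<open>No interval overlaps itself, so distinct pairs on a diagonal have distinct
      representatives.\<close>
    have "inj_on I {z \<in> Z. \<delta> z = m}"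
    proof (rule inj_onI)
      fix y z assume "y \<in> {z \<in> Z. \<delta> z = m}" "z \<in> {z \<in> Z. \<delta> z = m}" "I y = I z"
      then show "y = z" using cross[of y z] by (auto simp: overlap_def)
    qed
    then have "card {z \<in> Z. \<delta> z = m} = card (I ` {z \<in> Z. \<delta> z = m})"
      by (simp add: card_image)
    also have "\<dots> \<le> w"
    proof (rule clique_le)
      show "I ` {z \<in> Z. \<delta> z = m} \<subseteq> S" using I FS by blast
      show "overlap J J'" if "J \<in> I ` {z \<in> Z. \<delta> z = m}" "J' \<in> I ` {z \<in> Z. \<delta> z = m}" "J \<noteq> J'" for J J'
        using that cross by blast
    qed
    finally show ?thesis .
  qed
  have "k * Suc e = (\<Sum>j<k. Suc e)" by simp
  also have "\<dots> \<le> (\<Sum>j<k. card (pillars_seen \<pi> F (piece j)))"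
    using chain by (intro sum_mono) (auto simp: piece_def Suc_le_eq)
  also have "\<dots> = card Z" using finF by (simp add: Z_def card_SigmaI)
  also have "Z = (\<Union>m<d + k. {z \<in> Z. \<delta> z = m})" using \<delta> by auto
  also have "card \<dots> \<le> (\<Sum>m<d + k. card {z \<in> Z. \<delta> z = m})" by (rule card_UN_le) simp
  also have "\<dots> \<le> (\<Sum>m<d + k. w)" by (intro sum_mono fiber)
  finally show ?thesis by (simp add: mult.commute)
qed

section \<open>Inserting pillars and treating segments recursively\<close>

definition inside :: "real \<Rightarrow> real \<Rightarrow> interval set" where
  "inside s t = {I \<in> S. s \<le> fst I \<and> snd I \<le> t}"

text \<open>By the second clause, an interval with an end in the segment that is still unassigned
  lies inside it, so it is dealt with when this segment is treated.\<close>

definition segment :: "interval set \<Rightarrow> (interval \<Rightarrow> real) \<Rightarrow> real \<Rightarrow> real \<Rightarrow> bool" where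
  "segment F \<pi> s t \<longleftrightarrow> (\<forall>I\<in>F. \<pi> I \<notin> {s<..<t}) \<and>
    (\<forall>I\<in>S. ends I \<inter> {s<..<t} \<noteq> {} \<longrightarrow> I \<in> F \<union> inside s t)"

text \<open>Old pillars keep their places, but the colouring is quantified afresh: the invariants
  count pillars and never mention colours.\<close>

definition extendable :: "interval set \<Rightarrow> (interval \<Rightarrow> real) \<Rightarrow> real \<Rightarrow> real \<Rightarrow> bool" where
  "extendable F \<pi> s t \<longleftrightarrow>
    (\<exists>\<pi>' c'. valid (F \<union> inside s t) \<pi>' c' \<and> (\<forall>I\<in>F. \<pi>' I = \<pi> I))"

lemma insideD:
  assumes "valid F \<pi> c" "segment F \<pi> s t" "I \<in> inside s t"
  shows "I \<notin> F" "I \<in> S" "points I \<subseteq> {s<..<t}"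
proof -
  show "I \<in> S" "points I \<subseteq> {s<..<t}" using assms by (auto simp: inside_def points_def)
  then show "I \<notin> F" using assms(1,2) unfolding valid_def segment_def by blast
qed

text \<open>An assigned interval that overlaps a new one has an end in it, hence in the segment, so
  its pillar is seen there and any unseen colour is safe for \<open>p\<close>. Old pillars lie
  outside the segment and thus outside the new intervals, which gives the disjunction in
  \<open>valid\<close>.\<close>

lemma add_pillar:
  assumes V: "valid F \<pi> c" and seg: "segment F \<pi> s t" and p: "s < p" "p < t"
    and free: "card (pillars_seen \<pi> F {s<..<t}) < 7 * w"
  defines "N \<equiv> {I \<in> inside s t. p \<in> points I}"
  defines "\<pi>' \<equiv> \<lambda>I. if I \<in> N then p else \<pi> I"
  shows "\<exists>c'. valid (F \<union> N) \<pi>' c'"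
proof -
  have FS: "F \<subseteq> S" using V by (simp add: valid_def)
  have finF: "finite F" using FS by (rule finite_subset_system)
  have NF: "I \<notin> F" "I \<in> S" "p \<in> points I" "points I \<subseteq> {s<..<t}" if "I \<in> N" for I
    using insideD[OF V seg] that by (auto simp: N_def)
  have "card (c ` pillars_seen \<pi> F {s<..<t}) < card {..<7 * w}"
    using free card_image_le[of "pillars_seen \<pi> F {s<..<t}" c] finF by simp
  then obtain a where a: "a < 7 * w" "a \<notin> c ` pillars_seen \<pi> F {s<..<t}"
    using card_mono[of "c ` pillars_seen \<pi> F {s<..<t}" "{..<7 * w}"] finF
    by (metis finite_imageI finite_pillars_seen leD lessThan_iff subsetI)
  define c' where "c' = c(p := a)"
  have fresh: "\<pi> I \<noteq> p" if "I \<in> F" for I using seg that p by (auto simp: segment_def)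
  have sep: "\<pi> I \<notin> points J" if "I \<in> F" "J \<in> N" for I J
    using seg that NF(4)[of J] unfolding segment_def by blast
  have col: "c (\<pi> I) \<noteq> a" if IJ: "I \<in> F" "J \<in> N" "overlap I J" for I J
  proof -
    have "I \<in> S" "J \<in> S" using IJ FS NF by auto
    then have "ends I \<inter> {fst J<..<snd J} \<noteq> {}"
      using IJ(3) interval by (subst (asm) overlap_iff) (auto simp: ends_def)
    then have "\<pi> I \<in> pillars_seen \<pi> F {s<..<t}"
      using NF[OF IJ(2)] IJ(1) by (auto simp: pillars_seen_def points_def)
    then show ?thesis using a by auto
  qed
  have \<pi>'_F: "\<pi>' I = \<pi> I" "c' (\<pi> I) = c (\<pi> I)" if "I \<in> F" for I
    using NF(1)[of I] fresh[of I] that by (auto simp: \<pi>'_def c'_def)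
  have \<pi>'_N: "\<pi>' I = p" "c' p = a" if "I \<in> N" for I
    using that by (auto simp: \<pi>'_def c'_def)
  have "valid (F \<union> N) \<pi>' c'"
    unfolding valid_def
  proof (intro conjI ballI)
    show "F \<union> N \<subseteq> S" using FS NF by blast
  next
    fix I assume "I \<in> F \<union> N"
    then show "\<pi>' I \<in> points I" "c' (\<pi>' I) < 7 * w"
      using V a(1) NF(3)[of I] \<pi>'_F[of I] \<pi>'_N[of I] unfolding valid_def by fastforce+
  next
    fix I J assume IJ: "I \<in> F \<union> N" "J \<in> F \<union> N"
    consider "I \<in> F" "J \<in> F" | "I \<in> F" "J \<in> N" | "I \<in> N" "J \<in> F" | "I \<in> N" "J \<in> N"
      using IJ by blast
    then show "\<pi>' I \<noteq> \<pi>' J \<longrightarrow> (\<pi>' I \<notin> points J \<or> \<pi>' J \<notin> points I) \<and>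
      (overlap I J \<longrightarrow> c' (\<pi>' I) \<noteq> c' (\<pi>' J))"
    proof cases
      case 1
      then show ?thesis using V by (simp add: \<pi>'_F valid_def)
    next
      case 2
      then show ?thesis using sep[of I J] col[of I J] by (simp add: \<pi>'_F \<pi>'_N)
    next
      case 3
      then show ?thesis using sep[of J I] col[of J I] overlap_sym[of I J] by (auto simp: \<pi>'_F \<pi>'_N)
    next
      case 4
      then show ?thesis by (simp add: \<pi>'_N)
    qed
  qed
  then show ?thesis by blast
qed

text \<open>The left side is treated first. The intervals assigned meanwhile have no end to the
  right of \<open>p\<close>, so the right side, too, gains at most the one pillar \<open>p\<close>.
  The bound in \<open>sides\<close> covers all subsegments because further cuts are planned before
  \<open>p\<close> is added.\<close>

lemma split_segment:
  assumes V: "valid F \<pi> c" and seg: "segment F \<pi> s t" and p: "s < p" "p < t"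
    and free: "card (pillars_seen \<pi> F {s<..<t}) < 7 * w"
    and sides: "\<And>F' \<pi>' c' u v. (u, v) \<in> {(s, p), (p, t)} \<Longrightarrow> valid F' \<pi>' c' \<Longrightarrow> segment F' \<pi>' u v \<Longrightarrow>
      (\<And>x y. u \<le> x \<Longrightarrow> y \<le> v \<Longrightarrow>
        card (pillars_seen \<pi>' F' {x<..<y}) \<le> Suc (card (pillars_seen \<pi> F {x<..<y}))) \<Longrightarrow>
      extendable F' \<pi>' u v"
  shows "extendable F \<pi> s t"
proof -
  define N where "N = {I \<in> inside s t. p \<in> points I}"
  define \<pi>1 where "\<pi>1 I = (if I \<in> N then p else \<pi> I)" for I
  obtain c1 where V1: "valid (F \<union> N) \<pi>1 c1"
    using add_pillar[OF V seg p free] unfolding N_def \<pi>1_def by blast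
  have FS: "F \<subseteq> S" using V by (simp add: valid_def)
  have NF: "I \<notin> F" "I \<in> S" if "I \<in> N" for I
    using insideD[OF V seg] that by (auto simp: N_def)
  have \<pi>1: "\<pi>1 I = \<pi> I" if "I \<in> F" for I using NF(1)[of I] that by (auto simp: \<pi>1_def)
  have T: "inside s t = N \<union> inside s p \<union> inside p t"
    using p interval(1) by (auto simp: N_def inside_def points_def)
  have out: "\<pi>1 I \<notin> {s<..<p}" "\<pi>1 I \<notin> {p<..<t}" if "I \<in> F \<union> N" for I
    using that seg p \<pi>1 by (auto simp: segment_def \<pi>1_def)
  have seen1: "card (pillars_seen \<pi>1 (F \<union> N) B) \<le> Suc (card (pillars_seen \<pi> F B))" for B
  proof -
    have "pillars_seen \<pi>1 (F \<union> N) B \<subseteq> insert p (pillars_seen \<pi> F B)"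
      using \<pi>1 by (auto simp: pillars_seen_def \<pi>1_def)
    then have "card (pillars_seen \<pi>1 (F \<union> N) B) \<le> card (insert p (pillars_seen \<pi> F B))"
      using FS finite_subset_system by (intro card_mono) auto
    also have "\<dots> \<le> Suc (card (pillars_seen \<pi> F B))" by (rule card_insert_le_m1) auto
    finally show ?thesis .
  qed
  have ends_inside: "ends I \<inter> {u<..<v} = {}" if "I \<in> inside x y" "y \<le> u \<or> v \<le> x" for I x y u v
    using that interval(1)[of I] by (auto simp: inside_def ends_def)
  have "segment (F \<union> N) \<pi>1 s p"
    unfolding segment_def
  proof (intro conjI ballI impI)
    fix I assume I: "I \<in> S" "ends I \<inter> {s<..<p} \<noteq> {}"
    then have "I \<in> F \<union> inside s t" using seg p by (force simp: segment_def)
    then show "I \<in> F \<union> N \<union> inside s p" using T I ends_inside[of I p t s p] by blast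
  qed (use out in blast)
  then obtain \<pi>2 c2 where V2: "valid (F \<union> N \<union> inside s p) \<pi>2 c2" and \<pi>2: "\<forall>I\<in>F \<union> N. \<pi>2 I = \<pi>1 I"
    using sides[of s p, OF _ V1] seen1 unfolding extendable_def by blast
  have seg2: "segment (F \<union> N \<union> inside s p) \<pi>2 p t"
    unfolding segment_def
  proof (intro conjI ballI impI)
    fix I assume I: "I \<in> F \<union> N \<union> inside s p"
    show "\<pi>2 I \<notin> {p<..<t}"
    proof (cases "I \<in> F \<union> N")
      case True
      then show ?thesis using \<pi>2 out by simp
    next
      case False
      then have "I \<in> inside s p" "\<pi>2 I \<in> points I" using I V2 by (auto simp: valid_def)
      then show ?thesis by (auto simp: inside_def points_def)
    qed
  next
    fix I assume I: "I \<in> S" "ends I \<inter> {p<..<t} \<noteq> {}"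
    then have "I \<in> F \<union> inside s t" using seg p by (force simp: segment_def)
    then show "I \<in> F \<union> N \<union> inside s p \<union> inside p t" using T by blast
  qed
  have seen2: "card (pillars_seen \<pi>2 (F \<union> N \<union> inside s p) {x<..<y})
      \<le> Suc (card (pillars_seen \<pi> F {x<..<y}))" if "p \<le> x" for x y
  proof -
    have "{I \<in> F \<union> N \<union> inside s p. ends I \<inter> {x<..<y} \<noteq> {}} = {I \<in> F \<union> N. ends I \<inter> {x<..<y} \<noteq> {}}"
      using ends_inside[of _ s p x y] that by blast
    then have "pillars_seen \<pi>2 (F \<union> N \<union> inside s p) {x<..<y} = pillars_seen \<pi>1 (F \<union> N) {x<..<y}"
      using \<pi>2 by (auto simp: pillars_seen_def)
    then show ?thesis using seen1 by simp
  qed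
  obtain \<pi>3 c3 where V3: "valid (F \<union> N \<union> inside s p \<union> inside p t) \<pi>3 c3"
    and \<pi>3: "\<forall>I\<in>F \<union> N \<union> inside s p. \<pi>3 I = \<pi>2 I"
    using sides[of p t, OF _ V2 seg2] seen2 unfolding extendable_def by blast
  have "F \<union> N \<union> inside s p \<union> inside p t = F \<union> inside s t" using T by blast
  then show ?thesis
    unfolding extendable_def using V3 \<pi>1 \<pi>2 \<pi>3 by (intro exI[of _ \<pi>3] exI[of _ c3]) auto
qed

text \<open>Cutting at the middle point first makes the pillars of the cut a balanced binary tree: each
  piece sees only the \<open>j\<close> of them which are its ancestors.\<close>

lemma extendable_of_cuttable:
  assumes small: "\<And>F \<pi> c s t. valid F \<pi> c \<Longrightarrow> segment F \<pi> s t \<Longrightarrow>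
      card (pillars_seen \<pi> F {s<..<t}) \<le> d \<Longrightarrow> card (inside s t) < m \<Longrightarrow> extendable F \<pi> s t"
    and "valid F \<pi> c" "segment F \<pi> s t" "card (inside s t) < m"
    and "card (pillars_seen \<pi> F {s<..<t}) + j \<le> 7 * w"
    and "cuttable (\<lambda>u v. card (pillars_seen \<pi> F {u<..<v}) + j \<le> d) n s t" "n < 2 ^ j"
  shows "extendable F \<pi> s t"
  using assms(2-)
proof (induction j arbitrary: n F \<pi> c s t)
  case 0
  then show ?case using small by simp
next
  case (Suc j)
  show ?case
  proof (cases n)
    case 0
    then show ?thesis using small[of F \<pi> c s t] Suc.prems by simp
  next
    case (Suc n')
    \<comment> \<open>Cut at the middle: \<open>n' \<le> 2 * 2 ^ j - 2\<close>, so each half keeps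
      fewer than \<open>2 ^ j\<close> cuts.\<close>
    define a where "a = n' div 2"
    define b where "b = n' - a"
    have ab: "n = Suc (a + b)" "a < 2 ^ j" "b < 2 ^ j"
      using Suc.prems(6) Suc by (auto simp: a_def b_def)
    \<comment> \<open>The summand is a reserve for tree pillars still to come; \<open>p\<close> uses
      up one unit of it on either side.\<close>
    let ?Q = "\<lambda>u v. card (pillars_seen \<pi> F {u<..<v}) + Suc j \<le> d"
    obtain p where p: "s < p" "p < t" "cuttable ?Q a s p" "cuttable ?Q b p t"
      using cuttable_split Suc.prems(5) ab(1) by blast
    have finF: "finite F" using Suc.prems(1) finite_subset_system by (auto simp: valid_def)
    show ?thesis
    proof (rule split_segment[OF Suc.prems(1,2) p(1,2)])
      show "card (pillars_seen \<pi> F {s<..<t}) < 7 * w" using Suc.prems(4) by simp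
    next
      fix F' \<pi>' c' u v
      assume uv: "(u, v) \<in> {(s, p), (p, t)}" and V': "valid F' \<pi>' c'" "segment F' \<pi>' u v"
        and seen: "\<And>x y. u \<le> x \<Longrightarrow> y \<le> v \<Longrightarrow>
          card (pillars_seen \<pi>' F' {x<..<y}) \<le> Suc (card (pillars_seen \<pi> F {x<..<y}))"
      have "s \<le> u" "v \<le> t" using uv p by auto
      then have "inside u v \<subseteq> inside s t" by (auto simp: inside_def)
      moreover have "finite (inside s t)" by (rule finite_subset_system) (auto simp: inside_def)
      ultimately have "card (inside u v) < m"
        using Suc.prems(3) card_mono le_less_trans by blast
      moreover have "card (pillars_seen \<pi>' F' {u<..<v}) + j \<le> 7 * w"
        using seen[of u v] card_pillars_seen_mono[OF finF, of "{u<..<v}" "{s<..<t}" \<pi>] Suc.prems(4)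
          \<open>s \<le> u\<close> \<open>v \<le> t\<close> by fastforce
      moreover obtain n' where "cuttable ?Q n' u v" "n' < 2 ^ j" using uv p ab by auto
      moreover have "cuttable (\<lambda>x y. card (pillars_seen \<pi>' F' {x<..<y}) + j \<le> d) n' u v"
        using \<open>cuttable ?Q n' u v\<close> by (rule cuttable_mono) (use seen in fastforce)
      ultimately show "extendable F' \<pi>' u v" using Suc.IH V' by blast
    qed
  qed
qed

text \<open>The hypothesis says \<open>k * (2 * w + 1) \<le> 5 * w * w\<close>, hence
  \<open>2 * k < 5 * w\<close>, and \<open>5 * w \<le> 4 ^ w\<close> from \<open>w = 2\<close> on.
  For \<open>w = 1\<close> that last bound fails, but \<open>k \<le> 1\<close> is immediate.\<close>

lemma few_pieces:
  fixes k :: nat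
  assumes "k * Suc (3 * w) \<le> w * (5 * w + k)" "0 < w"
  shows "k < 2 ^ (2 * w - 1)"
proof (cases "w = 1")
  case True
  then show ?thesis using assms by simp
next
  case False
  have *: "5 * n \<le> (4::nat) ^ n" if "2 \<le> n" for n
    using that by (induction n rule: dec_induct) auto
  have "2 * k < 5 * w"
  proof (rule ccontr)
    assume *: "\<not> ?thesis"
    then have "w * (5 * w) \<le> w * (2 * k)" by (intro mult_le_mono2) simp
    moreover have "k + w * (2 * k) \<le> w * (5 * w)" using assms(1) by (simp add: algebra_simps)
    ultimately have "k = 0" by linarith
    with * assms(2) show False by simp
  qed
  also have "\<dots> \<le> 4 ^ w" using False assms(2) by (intro *) simp
  also have "\<dots> = 2 * 2 ^ (2 * w - 1)"
    using assms(2) by (simp add: power_mult power_Suc[symmetric] del: power_Suc)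
  finally show ?thesis by simp
qed

text \<open>The budget: after the first pillar at most \<open>5 * w + 1\<close> pillars are seen,
  and \<open>2 * w - 1\<close> tree levels raise this to at most \<open>7 * w\<close>. A finished
  piece sees at most \<open>3 * w\<close> old pillars and \<open>1 + (2 * w - 1)\<close> new ones,
  again \<open>5 * w\<close>, so the induction applies.\<close>

lemma extendable_segment:
  assumes "valid F \<pi> c" "segment F \<pi> s t" "card (pillars_seen \<pi> F {s<..<t}) \<le> 5 * w"
  shows "extendable F \<pi> s t"
  using assms
proof (induction "card (inside s t)" arbitrary: F \<pi> c s t rule: less_induct)
  case less
  have finF: "finite F" using less.prems(1) finite_subset_system by (auto simp: valid_def)
  have fin: "finite (inside s t)" by (rule finite_subset_system) (auto simp: inside_def)
  show ?case
  proof (cases "inside s t = {}")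
    case True
    then show ?thesis using less.prems(1) by (auto simp: extendable_def)
  next
    case False
    then obtain J where J: "J \<in> inside s t" by blast
    then have "J \<in> S" by (simp add: inside_def)
    then have w: "0 < w" using clique_le[of "{J}"] by simp
    \<comment> \<open>A point of \<open>J\<close> is taken so that \<open>J\<close> lies inside
      neither side and the induction measure drops.\<close>
    define p where "p = (fst J + snd J) / 2"
    have Jp: "fst J < p" "p < snd J" using interval(1)[OF \<open>J \<in> S\<close>] by (auto simp: p_def)
    then have p: "s < p" "p < t" using J by (auto simp: inside_def)
    show ?thesis
    proof (rule split_segment[OF less.prems(1,2) p])
      show "card (pillars_seen \<pi> F {s<..<t}) < 7 * w" using less.prems(3) w by simp
    next
      fix F' \<pi>' c' u v
      assume uv: "(u, v) \<in> {(s, p), (p, t)}" and V': "valid F' \<pi>' c'" "segment F' \<pi>' u v"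
        and seen: "\<And>x y. u \<le> x \<Longrightarrow> y \<le> v \<Longrightarrow>
          card (pillars_seen \<pi>' F' {x<..<y}) \<le> Suc (card (pillars_seen \<pi> F {x<..<y}))"
      have uv': "s \<le> u" "v \<le> t" "u < v" using uv p by auto
      have "J \<notin> inside u v" using uv Jp by (auto simp: inside_def)
      then have "inside u v \<subset> inside s t" using J uv' by (auto simp: inside_def)
      then have smaller: "card (inside u v) < card (inside s t)"
        using fin by (rule psubset_card_mono[rotated])
      have d: "card (pillars_seen \<pi> F {u<..<v}) \<le> 5 * w"
        using card_pillars_seen_mono[OF finF, of "{u<..<v}" "{s<..<t}" \<pi>] less.prems(3) uv'
        by fastforce
      let ?k = "2 ^ (2 * w - 1) :: nat"
      have "\<not> (\<exists>q. q 0 = u \<and> q ?k < v \<and>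
        (\<forall>j<?k. q j < q (Suc j) \<and> 3 * w < card (pillars_seen \<pi> F {q j<..q (Suc j)})))"
      proof
        assume "\<exists>q. q 0 = u \<and> q ?k < v \<and>
          (\<forall>j<?k. q j < q (Suc j) \<and> 3 * w < card (pillars_seen \<pi> F {q j<..q (Suc j)}))"
        then obtain q where q: "q 0 = u" "q ?k < v"
          "\<forall>j<?k. q j < q (Suc j) \<and> 3 * w < card (pillars_seen \<pi> F {q j<..q (Suc j)})"
          by blast
        have "\<pi> I \<notin> {u<..<v}" if "I \<in> F" for I
          using less.prems(2) that uv' by (force simp: segment_def)
        from few_pieces[OF chain_length[OF less.prems(1) this d q] w] show False by simp
      qed
      then obtain n where n: "n < ?k" "cuttable (\<lambda>u v. card (pillars_seen \<pi> F {u<..<v}) \<le> 3 * w) n u v"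
        using cuttable_or_chain[OF finF uv'(3), of ?k \<pi> "3 * w"] by blast
      \<comment> \<open>The cuts were chosen for the old \<open>F\<close> and \<open>\<pi>\<close>;
        passing to \<open>F'\<close> and \<open>\<pi>'\<close> costs one pillar, covered by the gap
        between \<open>2 * w\<close> and the depth \<open>2 * w - 1\<close>.\<close>
      show "extendable F' \<pi>' u v"
      proof (rule extendable_of_cuttable[OF _ V' smaller])
        show "card (pillars_seen \<pi>' F' {u<..<v}) + (2 * w - 1) \<le> 7 * w"
          using seen[of u v] d w by simp
        show "cuttable (\<lambda>u v. card (pillars_seen \<pi>' F' {u<..<v}) + (2 * w - 1) \<le> 5 * w) n u v"
          using n(2) by (rule cuttable_mono) (use seen w in fastforce)
      qed (use n(1) less.hyps in blast)+
    qed
  qed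
qed

lemma pillar_assignment:
  "\<exists>\<pi> c. valid S \<pi> c"
proof -
  have "inside 0 1 = S" using interval by (auto simp: inside_def less_imp_le)
  \<comment> \<open>With nothing assigned yet, pillars and colours can start from arbitrary
    values.\<close>
  moreover have "valid {} undefined undefined" by (simp add: valid_def)
  moreover have "segment {} undefined 0 1" using calculation(1) by (simp add: segment_def)
  ultimately show ?thesis
    using extendable_segment[of "{}" undefined undefined 0 1]
    by (auto simp: extendable_def pillars_seen_def)
qed

end

section \<open>From the pillar assignment to the partition of a circle graph\<close>

theorem theorem2:
  fixes V :: "'a set" and E :: "'a set set"
  assumes "circle_graph V E"
  shows "\<exists>P :: nat \<Rightarrow> 'a set.
           (\<Union>i<7 * clique_number V E. P i) = V \<and>
           disjoint_family_on P {..<7 * clique_number V E} \<and>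
           (\<forall>i<7 * clique_number V E. permutation_graph (P i) (induced_edges E (P i)))"
proof -
  define w where "w = clique_number V E"
  obtain S f where VE: "simple_graph V E" and S: "interval_system S" and f: "bij_betw f V S"
    and f_edges: "\<And>u v. u \<in> V \<Longrightarrow> v \<in> V \<Longrightarrow> {u, v} \<in> E \<longleftrightarrow> {f u, f v} \<in> overlap_edges S"
    using assms by (auto simp: circle_graph_def graph_isomorphic_def)
  have fV: "f v \<in> S" if "v \<in> V" for v using f that by (auto simp: bij_betw_def)
  have inj: "inj_on f V" using f by (simp add: bij_betw_def)
  have edge_iff: "{u, v} \<in> E \<longleftrightarrow> overlap (f u) (f v)" if "u \<in> V" "v \<in> V" for u v
    using that by (simp add: f_edges overlap_edges_iff fV)
  have finV: "finite V" using VE by (simp add: simple_graph_def)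
  \<comment> \<open>Pairwise overlapping intervals pull back along \<open>f\<close> to a clique of
    the same size.\<close>
  interpret bounded_interval_system S w
  proof
    fix K assume K: "K \<subseteq> S" "\<And>I J. I \<in> K \<Longrightarrow> J \<in> K \<Longrightarrow> I \<noteq> J \<Longrightarrow> overlap I J"
    define K' where "K' = {v \<in> V. f v \<in> K}"
    have "f ` K' = K" using f K(1) by (auto simp: K'_def bij_betw_def)
    moreover have "inj_on f K'" using inj by (rule inj_on_subset) (auto simp: K'_def)
    ultimately have "card K' = card K" using card_image by metis
    moreover have "clique K' E"
      unfolding clique_def
    proof (intro ballI impI)
      fix u v assume "u \<in> K'" "v \<in> K'" "u \<noteq> v"
      then show "{u, v} \<in> E"
        using K(2)[of "f u" "f v"] inj by (auto simp: K'_def edge_iff dest: inj_onD)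
    qed
    moreover have "K' \<subseteq> V" by (auto simp: K'_def)
    moreover have "finite {card K |K. K \<subseteq> V \<and> clique K E}"
      by (rule finite_subset[of _ "card ` Pow V"]) (use finV in blast, simp add: finV)
    ultimately show "card K \<le> w"
      unfolding w_def clique_number_def by (metis (mono_tags, lifting) Max_ge mem_Collect_eq)
  qed (rule S)
  obtain \<pi> c where V: "valid S \<pi> c" using pillar_assignment by blast
  define P where "P i = {v \<in> V. c (\<pi> (f v)) = i}" for i
  have "(\<Union>i<7 * w. P i) = V" using V fV by (auto simp: P_def valid_def)
  moreover have "disjoint_family_on P {..<7 * w}" by (auto simp: disjoint_family_on_def P_def)
  moreover have "permutation_graph (P i) (induced_edges E (P i))" for i
  proof -
    let ?C = "f ` P i"
    have C: "?C \<subseteq> S" using fV by (auto simp: P_def)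
    have "interval_system ?C" using S C by (rule interval_system_subset)
    \<comment> \<open>Within a colour class, different pillars would give overlapping intervals
      different colours.\<close>
    moreover have "\<pi> I = \<pi> J" if "I \<in> ?C" "J \<in> ?C" "overlap I J" for I J
      using that V fV unfolding valid_def P_def by fastforce
    ultimately have "permutation_graph ?C (overlap_edges ?C)"
      using V C by (intro permutation_graph_of_pillars[of _ \<pi>]) (auto simp: valid_def)
    then obtain T p h where T: "interval_system T" "pillar T p" "\<forall>I\<in>T. p \<in> points I"
      and h: "bij_betw h ?C T"
      and h_edges: "\<forall>I\<in>?C. \<forall>J\<in>?C. {I, J} \<in> overlap_edges ?C \<longleftrightarrow> {h I, h J} \<in> overlap_edges T"
      by (auto simp: permutation_graph_def graph_isomorphic_def)
    have "inj_on f (P i)" using inj by (rule inj_on_subset) (auto simp: P_def)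
    then have "bij_betw (h \<circ> f) (P i) T"
      using h by (intro bij_betw_trans[of f]) (auto simp: bij_betw_def)
    moreover have "{u, v} \<in> induced_edges E (P i) \<longleftrightarrow> {(h \<circ> f) u, (h \<circ> f) v} \<in> overlap_edges T"
      if uv: "u \<in> P i" "v \<in> P i" for u v
    proof -
      have "{u, v} \<in> induced_edges E (P i) \<longleftrightarrow> overlap (f u) (f v)"
        using uv by (auto simp: induced_edges_def edge_iff P_def)
      also have "\<dots> \<longleftrightarrow> {f u, f v} \<in> overlap_edges ?C" using uv by (simp add: overlap_edges_iff)
      finally show ?thesis using h_edges uv by auto
    qed
    ultimately have "graph_isomorphic (P i) (induced_edges E (P i)) T (overlap_edges T)"
      unfolding graph_isomorphic_def by blast
    moreover have "simple_graph (P i) (induced_edges E (P i))"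
      using VE by (auto simp: simple_graph_def induced_edges_def P_def nsets_def)
    ultimately show ?thesis using T unfolding permutation_graph_def by blast
  qed
  ultimately show ?thesis unfolding w_def by blast
qed

end
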